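(* Let $n\ge 5$ be odd, and let $\mathcal{G}=\{G_i\mid 1\le i\le n\}$ be a collection of graphs with at least one $G_i$ nontrivial. Let $G$ be the join of $\mathcal{G}$ along the cycle $C_n$. Similarly, let $\overline{\mathcal{G}}=\{\overline{G}_i\mid 1\le i\le n\}$ and let $G^0$ be the join of $\overline{\mathcal{G}}$ along $C_n$. Then, for $k,\ell\in\mathbb{N}$: (1) $\operatorname{M}^k(G)=G$ if and only if $\mu(n)\mid k$ and $k$ is even. (2) $\operatorname{M}^k(G)=G^0$ if and only if $\mu(n)\mid k$ and $k$ is odd. (3) If $n\ge 7$ and $\overline{G}_i\ncong G_i=G_j$ for all $i,j$ (that is, all $G_i$ are copies of one and the same graph, which is not self-complementary), then $\operatorname{M}^k(G)\cong\operatorname{M}^\ell(G)$ if and only if $k\equiv\ell\pmod 2$.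
   Context: $\mathbb{N}$ denotes the nonnegative integers. All graphs are finite and simple with nonempty vertex set; a graph is trivial if it is $K_1$ and nontrivial if it has more than one vertex. $\overline{G}$ is the complement of $G$, on the same vertex set. The metamour graph $\operatorname{M}(G)$ has vertex set $V(G)$, with $x,y$ adjacent iff $d_G(x,y)=2$; $\operatorname{M}^0(G)=G$ and $\operatorname{M}^{k+1}(G)=\operatorname{M}(\operatorname{M}^k(G))$. Equality $=$ of graphs means equality as labeled graphs; $\cong$ means isomorphism. Join along a graph: given a graph $H=(V,E)$ and a collection of graphs $\{G_v\mid v\in V\}$, the join of the collection along $H$ is obtained from the disjoint union $\bigcup_{v\in V}G_v$ by adding, for every $vw\in E$, all possible edges between $V(G_v)$ and $V(G_w)$. The vertices of $C_n$ are $1,\dots,n$ read modulo $n$, with $i$ adjacent to $i+1$. For odd positive $n$, $\mu(n)=\min\{k\in\mathbb{Z}^+\mid 2^k\equiv\pm1\pmod n\}$. *)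

theory Defs
  imports "Graph_Theory.Graph_Theory" "HOL-Number_Theory.Cong"
begin

text \<open>
  Finite simple graphs are the values of type \<open>'a pair_pre_digraph\<close> satisfying
  \<^locale>\<open>pair_graph\<close>: each edge is stored as its two opposite arcs.  Hence \<open>=\<close> on this type is
  equality of labeled graphs.
\<close>

definition nontrivial :: "'a pair_pre_digraph \<Rightarrow> bool" where
  "nontrivial G \<longleftrightarrow> 1 < card (pverts G)"

definition complement_graph :: "'a pair_pre_digraph \<Rightarrow> 'a pair_pre_digraph" where
  "complement_graph G =
    \<lparr> pverts = pverts G,
      parcs = {(x, y). x \<in> pverts G \<and> y \<in> pverts G \<and> x \<noteq> y \<and> (x, y) \<notin> parcs G} \<rparr>"

text \<open>
  With unit arc weights, the library's \<^const>\<open>wf_digraph.\<mu>\<close> is the usual graph distance; it is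
  \<open>\<infinity>\<close> for vertices in different components.
\<close>

definition graph_dist :: "'a pair_pre_digraph \<Rightarrow> 'a \<Rightarrow> 'a \<Rightarrow> ereal" where
  "graph_dist G = wf_digraph.\<mu> (with_proj G) (\<lambda>_. 1)"

definition metamour :: "'a pair_pre_digraph \<Rightarrow> 'a pair_pre_digraph" where
  "metamour G =
    \<lparr> pverts = pverts G,
      parcs = {(x, y). x \<in> pverts G \<and> y \<in> pverts G \<and> graph_dist G x y = 2} \<rparr>"

text \<open>
  The disjoint union is formed by tagging: the copy of \<open>x\<close> in \<open>G v\<close> is the pair \<open>(v, x)\<close>.
\<close>

definition join_along ::
  "'v pair_pre_digraph \<Rightarrow> ('v \<Rightarrow> 'a pair_pre_digraph) \<Rightarrow> ('v \<times> 'a) pair_pre_digraph" where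
  "join_along H G =
    \<lparr> pverts = (SIGMA v : pverts H. pverts (G v)),
      parcs = {((v, x), (v, y)) | v x y. v \<in> pverts H \<and> (x, y) \<in> parcs (G v)} \<union>
              {((v, x), (w, y)) | v w x y.
                 (v, w) \<in> parcs H \<and> x \<in> pverts (G v) \<and> y \<in> pverts (G w)} \<rparr>"

text \<open>Only meaningful for \<open>n \<ge> 3\<close>.\<close>

definition cycle_graph :: "nat \<Rightarrow> nat pair_pre_digraph" where
  "cycle_graph n =
    \<lparr> pverts = {1..n},
      parcs = {(i, j). i \<in> {1..n} \<and> j \<in> {1..n} \<and>
                 ([j = i + 1] (mod n) \<or> [i = j + 1] (mod n))} \<rparr>"

abbreviation graph_iso :: "'a pair_pre_digraph \<Rightarrow> 'b pair_pre_digraph \<Rightarrow> bool" where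
  "graph_iso G H \<equiv> digraph_iso (with_proj G) (with_proj H)"

text \<open>The congruences are over the integers because of \<open>-1\<close>.\<close>

definition mu :: "nat \<Rightarrow> nat" where
  "mu n = (LEAST k. 0 < k \<and> ([2 ^ k = 1] (mod (int n)) \<or> [2 ^ k = - 1] (mod (int n))))"

lemma pair_graph_iff:
  "pair_graph G \<longleftrightarrow> finite (pverts G) \<and> parcs G \<subseteq> pverts G \<times> pverts G \<and>
     (\<forall>x. (x, x) \<notin> parcs G) \<and> (\<forall>x y. (x, y) \<in> parcs G \<longrightarrow> (y, x) \<in> parcs G)"
proof
  assume "pair_graph G"
  then interpret pair_graph G .
  show "finite (pverts G) \<and> parcs G \<subseteq> pverts G \<times> pverts G \<and>
     (\<forall>x. (x, x) \<notin> parcs G) \<and> (\<forall>x y. (x, y) \<in> parcs G \<longrightarrow> (y, x) \<in> parcs G)"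
    using pair_finite_verts pair_no_loops[of "(x, x)" for x] pair_sym_arcs
    by (force simp: symmetric_def dest: in_arcsD1 in_arcsD2 symD)
next
  assume *: "finite (pverts G) \<and> parcs G \<subseteq> pverts G \<times> pverts G \<and>
     (\<forall>x. (x, x) \<notin> parcs G) \<and> (\<forall>x y. (x, y) \<in> parcs G \<longrightarrow> (y, x) \<in> parcs G)"
  then have "finite (parcs G)"
    by (meson finite_SigmaI finite_subset)
  with * show "pair_graph G"
    by unfold_locales (auto simp: symmetric_def sym_def)
qed

lemma pair_graph_complement_graph:
  "pair_graph G \<Longrightarrow> pair_graph (complement_graph G)"
  by (auto simp: pair_graph_iff complement_graph_def)

lemma pair_graph_cycle_graph:
  assumes "3 \<le> n"
  shows "pair_graph (cycle_graph n)"
proof -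
  have "\<not> [i = i + 1] (mod n)" for i :: nat
    using assms cong_add_lcancel_0_nat[of i 1 n] cong_sym[of i "i + 1" n]
    by (auto simp: cong_0_iff)
  then show ?thesis
    by (auto simp: pair_graph_iff cycle_graph_def)
qed

lemma pair_graph_join_along:
  assumes "pair_graph H" "\<And>v. v \<in> pverts H \<Longrightarrow> pair_graph (G v)"
  shows "pair_graph (join_along H G)"
  using assms unfolding pair_graph_iff join_along_def by simp blast

lemma graph_dist_eq:
  assumes "pair_graph G"
  shows "graph_dist G x y = (INF p\<in>{p. pre_digraph.awalk (with_proj G) x p y}. ereal (length p))"
proof -
  interpret pair_graph G by fact
  have "awalk_cost (\<lambda>_. 1) p = length p" for p :: "('a \<times> 'a) list"
    by (induction p) (auto simp: awalk_cost_def)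
  then show ?thesis
    by (simp add: graph_dist_def \<mu>_def)
qed

end

theory Submission
  imports Defs "HOL-Number_Theory.Residues"
begin

text \<open>
  In a join of nonempty graphs along a graph \<open>H\<close> without isolated vertices, two vertices of
  different parts are at distance \<open>2\<close> precisely when the indices of their parts are at distance
  \<open>2\<close> in \<open>H\<close>; two vertices of the same part always have a common neighbour in an adjacent part,
  so they are at distance \<open>2\<close> precisely when they are distinct and not adjacent.  Hence the
  metamour graph of the join is the join of the complemented parts along the metamour graph of
  \<open>H\<close> (\<open>metamour_join_along\<close>).  The cycle \<open>C\<^sub>n\<close> is the circulant graph with step \<open>1\<close>, and for odd
  \<open>n \<ge> 5\<close> taking metamours doubles a step that is coprime to \<open>n\<close> (\<open>metamour_circulant\<close>).  So
  \<open>M\<^sup>k(G)\<close> is the join along the circulant with step \<open>2\<^sup>k\<close> of the parts complemented \<open>k\<close> times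
  (\<open>metamour_funpow_join_along_cycle\<close>).

  Labeled equality of joins splits into equality of the index graphs and of the parts
  (\<open>join_along_eq_iff\<close>).  The circulants with steps \<open>2\<^sup>k\<close> and \<open>1\<close> are equal precisely when
  \<open>2\<^sup>k \<equiv> \<plusminus>1 (mod n)\<close>, that is, when \<open>\<mu>(n)\<close> divides \<open>k\<close>; and a nontrivial part, which differs from
  its complement, records the parity of \<open>k\<close>.  This gives the first two claims.

  For the third, all circulants with coprime steps are isomorphic, so with identical parts \<open>K\<close> only
  the parity of \<open>k\<close> can matter.  That it does matter follows by recovering the parts from the
  unlabeled join: the ball of radius \<open>2\<close> around a vertex consists of whole parts and depends only on
  the part that contains the centre, and for \<open>n \<ge> 7\<close> different parts have different balls.  Being in
  the same part therefore means having equal balls, a property preserved by isomorphisms, and an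
  isomorphism between joins of copies of \<open>K\<close> and of its complement would make \<open>K\<close>
  self-complementary (\<open>graph_iso_join_along_parts\<close>).
\<close>


section \<open>Metamours of joins\<close>

lemma pair_graphD:
  assumes "pair_graph G"
  shows "finite (pverts G)"
    and "(x, y) \<in> parcs G \<Longrightarrow> x \<in> pverts G"
    and "(x, y) \<in> parcs G \<Longrightarrow> y \<in> pverts G"
    and "(x, x) \<notin> parcs G"
    and "(x, y) \<in> parcs G \<Longrightarrow> (y, x) \<in> parcs G"
  using assms by (auto simp: pair_graph_iff)

lemma graph_dist_eq_2_iff:
  assumes "pair_graph G" and x: "x \<in> pverts G" and y: "y \<in> pverts G"
  shows "graph_dist G x y = 2 \<longleftrightarrow>
    x \<noteq> y \<and> (x, y) \<notin> parcs G \<and> (\<exists>z. (x, z) \<in> parcs G \<and> (z, y) \<in> parcs G)"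
proof -
  interpret pair_graph G by fact
  have le: "graph_dist G x y \<le> ereal (length p)" if "awalk x p y" for p
    unfolding graph_dist_eq[OF assms(1)] using that by (intro INF_lower) auto
  have walk0: "awalk x [] y" if "x = y"
    using that x by (simp add: awalk_Nil_iff)
  have walk1: "awalk x [(x, y)] y" if "(x, y) \<in> parcs G"
    using that y by (simp add: awalk_Cons_iff awalk_Nil_iff)
  have walk2: "awalk x [(x, z), (z, y)] y" if "(x, z) \<in> parcs G" "(z, y) \<in> parcs G" for z
    using that y by (simp add: awalk_Cons_iff awalk_Nil_iff)
  have walkD: "x = y \<or> (x, y) \<in> parcs G \<or> 2 \<le> length p" if "awalk x p y" for p
    using that
    by (cases p; cases "tl p") (auto simp: awalk_Cons_iff awalk_Nil_iff)
  show ?thesis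
  proof
    assume d: "graph_dist G x y = 2"
    have xy: "x \<noteq> y" "(x, y) \<notin> parcs G"
      using le[OF walk0] le[OF walk1] d by (auto simp: one_ereal_def)
    have "graph_dist G x y < ereal 3"
      by (simp add: d)
    then obtain p where p: "awalk x p y" "length p < 3"
      unfolding graph_dist_eq[OF assms(1)] INF_less_iff by auto
    with walkD[OF p(1)] xy have "length p = 2"
      by linarith
    then obtain u z z' w where "p = [(u, z), (z', w)]"
      by (auto simp: numeral_2_eq_2 length_Suc_conv)
    with p(1) have "(x, z) \<in> parcs G" "(z, y) \<in> parcs G"
      by (auto simp: awalk_Cons_iff awalk_Nil_iff)
    with xy show "x \<noteq> y \<and> (x, y) \<notin> parcs G \<and> (\<exists>z. (x, z) \<in> parcs G \<and> (z, y) \<in> parcs G)"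
      by blast
  next
    assume *: "x \<noteq> y \<and> (x, y) \<notin> parcs G \<and> (\<exists>z. (x, z) \<in> parcs G \<and> (z, y) \<in> parcs G)"
    then obtain z where "(x, z) \<in> parcs G" "(z, y) \<in> parcs G"
      by blast
    from le[OF walk2[OF this]] have "graph_dist G x y \<le> 2"
      by simp
    moreover have "2 \<le> graph_dist G x y"
      unfolding graph_dist_eq[OF assms(1)] using walkD * by (intro INF_greatest) auto
    ultimately show "graph_dist G x y = 2"
      by (rule antisym)
  qed
qed

lemma pverts_metamour [simp]: "pverts (metamour G) = pverts G"
  by (simp add: metamour_def)

lemma parcs_metamour_iff:
  assumes "pair_graph G"
  shows "(x, y) \<in> parcs (metamour G) \<longleftrightarrow>
    x \<noteq> y \<and> (x, y) \<notin> parcs G \<and> (\<exists>z. (x, z) \<in> parcs G \<and> (z, y) \<in> parcs G)"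
  using graph_dist_eq_2_iff[OF assms, of x y] pair_graphD[OF assms]
  by (auto simp: metamour_def)

lemma pverts_complement_graph [simp]: "pverts (complement_graph G) = pverts G"
  by (simp add: complement_graph_def)

lemma parcs_complement_graph_iff:
  "(x, y) \<in> parcs (complement_graph G) \<longleftrightarrow>
    x \<in> pverts G \<and> y \<in> pverts G \<and> x \<noteq> y \<and> (x, y) \<notin> parcs G"
  by (simp add: complement_graph_def)

lemma pair_graph_eqI:
  fixes G H :: "'a pair_pre_digraph"
  assumes "pverts G = pverts H" and "\<And>x y. (x, y) \<in> parcs G \<longleftrightarrow> (x, y) \<in> parcs H"
  shows "G = H"
  using assms by (intro pair_pre_digraph.equality) auto

lemma pverts_join_along [simp]: "(v, x) \<in> pverts (join_along H G) \<longleftrightarrow> v \<in> pverts H \<and> x \<in> pverts (G v)"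
  by (auto simp: join_along_def)

lemma parcs_join_along_iff:
  assumes "pair_graph H"
  shows "((v, x), (w, y)) \<in> parcs (join_along H G) \<longleftrightarrow>
    v \<in> pverts H \<and> v = w \<and> (x, y) \<in> parcs (G v) \<or>
    (v, w) \<in> parcs H \<and> x \<in> pverts (G v) \<and> y \<in> pverts (G w)"
  by (auto simp: join_along_def)

lemma metamour_join_along:
  fixes H :: "'v pair_pre_digraph" and G :: "'v \<Rightarrow> 'a pair_pre_digraph"
  assumes H: "pair_graph H"
    and no_isolated: "\<And>v. v \<in> pverts H \<Longrightarrow> \<exists>w. (v, w) \<in> parcs H"
    and G: "\<And>v. v \<in> pverts H \<Longrightarrow> pair_graph (G v)"
    and nonempty: "\<And>v. v \<in> pverts H \<Longrightarrow> pverts (G v) \<noteq> {}"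
  shows "metamour (join_along H G) = join_along (metamour H) (\<lambda>v. complement_graph (G v))"
    (is "?L = ?R")
proof -
  have J: "pair_graph (join_along H G)"
    by (rule pair_graph_join_along[OF H G])
  note HD = pair_graphD[OF H] and GD = pair_graphD[OF G]
  have M: "pair_graph (metamour H)"
    using HD by (auto simp: pair_graph_iff parcs_metamour_iff[OF H]) blast
  have R: "pair_graph ?R"
    using M G by (intro pair_graph_join_along pair_graph_complement_graph) auto
  have V: "pverts ?L = pverts ?R"
    by (auto simp: join_along_def)
  show ?thesis
  proof (rule pair_graph_eqI)
    fix p q :: "'v \<times> 'a"
    obtain v x w y where pq: "p = (v, x)" "q = (w, y)"
      by fastforce
    show "(p, q) \<in> parcs ?L \<longleftrightarrow> (p, q) \<in> parcs ?R"
    proof (cases "p \<in> pverts ?R \<and> q \<in> pverts ?R")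
      case False
      then have "(p, q) \<notin> parcs ?L"
        unfolding V[symmetric] by (auto simp: metamour_def)
      with False pair_graphD(2,3)[OF R] show ?thesis
        by blast
    next
      case True
      then have v: "v \<in> pverts H" and w: "w \<in> pverts H"
        and x: "x \<in> pverts (G v)" and y: "y \<in> pverts (G w)"
        by (auto simp: pq)
      show ?thesis
      proof (cases "v = w")
        case eq: True
        obtain u where u: "(v, u) \<in> parcs H"
          using no_isolated[OF v] by blast
        then obtain z where z: "z \<in> pverts (G u)"
          using nonempty[OF HD(3)[OF u]] by blast
        have "((v, x), (u, z)) \<in> parcs (join_along H G)" "((u, z), (w, y)) \<in> parcs (join_along H G)"
          using u HD(5)[OF u] z x y eq by (simp_all add: parcs_join_along_iff[OF H])
        then have "(p, q) \<in> parcs ?L \<longleftrightarrow> p \<noteq> q \<and> (p, q) \<notin> parcs (join_along H G)"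
          unfolding pq parcs_metamour_iff[OF J] by blast
        also have "\<dots> \<longleftrightarrow> x \<noteq> y \<and> (x, y) \<notin> parcs (G v)"
          using v HD(4) eq by (simp add: pq parcs_join_along_iff[OF H])
        also have "\<dots> \<longleftrightarrow> (p, q) \<in> parcs ?R"
          using v x y pair_graphD(4)[OF M] eq
          by (simp add: pq parcs_join_along_iff[OF M] parcs_complement_graph_iff)
        finally show ?thesis .
      next
        case neq: False
        have common: "(\<exists>r. ((v, x), r) \<in> parcs (join_along H G) \<and> (r, (w, y)) \<in> parcs (join_along H G))
            \<longleftrightarrow> (\<exists>u. (v, u) \<in> parcs H \<and> (u, w) \<in> parcs H)" if na: "(v, w) \<notin> parcs H"
        proof
          assume "\<exists>r. ((v, x), r) \<in> parcs (join_along H G) \<and> (r, (w, y)) \<in> parcs (join_along H G)"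
          then show "\<exists>u. (v, u) \<in> parcs H \<and> (u, w) \<in> parcs H"
            using na neq by (auto simp: parcs_join_along_iff[OF H])
        next
          assume "\<exists>u. (v, u) \<in> parcs H \<and> (u, w) \<in> parcs H"
          then obtain u where u: "(v, u) \<in> parcs H" "(u, w) \<in> parcs H"
            by blast
          then obtain z where "z \<in> pverts (G u)"
            using nonempty[OF HD(3)[OF u(1)]] by blast
          with u x y
          have "((v, x), (u, z)) \<in> parcs (join_along H G) \<and> ((u, z), (w, y)) \<in> parcs (join_along H G)"
            by (simp add: parcs_join_along_iff[OF H])
          then show "\<exists>r. ((v, x), r) \<in> parcs (join_along H G) \<and> (r, (w, y)) \<in> parcs (join_along H G)"
            by blast
        qed
        have "(p, q) \<in> parcs (join_along H G) \<longleftrightarrow> (v, w) \<in> parcs H"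
          using x y neq by (simp add: pq parcs_join_along_iff[OF H])
        moreover have "(p, q) \<in> parcs ?R \<longleftrightarrow> (v, w) \<in> parcs (metamour H)"
          using x y neq by (simp add: pq parcs_join_along_iff[OF M])
        ultimately show ?thesis
          unfolding parcs_metamour_iff[OF J] parcs_metamour_iff[OF H]
          using common neq by (simp add: pq) blast
      qed
    qed
  qed (rule V)
qed


section \<open>Labeled equality of joins and iterated complements\<close>

lemma join_along_cong:
  fixes H :: "'v pair_pre_digraph" and G :: "'v \<Rightarrow> 'a pair_pre_digraph"
  assumes "pair_graph H" and "\<And>v. v \<in> pverts H \<Longrightarrow> G v = G' v"
  shows "join_along H G = join_along H G'"
proof (rule pair_graph_eqI)
  show "pverts (join_along H G) = pverts (join_along H G')"
    using assms(2) by (auto simp: join_along_def)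
  fix p q :: "'v \<times> 'a"
  show "(p, q) \<in> parcs (join_along H G) \<longleftrightarrow> (p, q) \<in> parcs (join_along H G')"
    using assms(2) pair_graphD[OF assms(1)]
    by (cases p; cases q) (auto simp: parcs_join_along_iff[OF assms(1)])
qed

lemma join_along_eq_iff:
  assumes H: "pair_graph H" and H': "pair_graph H'" and V: "pverts H = pverts H'"
    and G: "\<And>v. v \<in> pverts H \<Longrightarrow> pverts (G v) \<noteq> {} \<and> pverts (G' v) = pverts (G v)"
  shows "join_along H G = join_along H' G' \<longleftrightarrow> H = H' \<and> (\<forall>v \<in> pverts H. G v = G' v)"
proof
  assume eq: "join_along H G = join_along H' G'"
  have arcs: "v \<in> pverts H \<and> v = w \<and> (x, y) \<in> parcs (G v) \<or>
        (v, w) \<in> parcs H \<and> x \<in> pverts (G v) \<and> y \<in> pverts (G w) \<longleftrightarrow>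
      v \<in> pverts H' \<and> v = w \<and> (x, y) \<in> parcs (G' v) \<or>
        (v, w) \<in> parcs H' \<and> x \<in> pverts (G' v) \<and> y \<in> pverts (G' w)" for v x w y
    unfolding parcs_join_along_iff[OF H, symmetric] eq parcs_join_along_iff[OF H', symmetric] ..
  have "H = H'"
  proof (rule pair_graph_eqI)
    fix v w
    show "(v, w) \<in> parcs H \<longleftrightarrow> (v, w) \<in> parcs H'"
    proof (cases "v \<in> pverts H \<and> w \<in> pverts H \<and> v \<noteq> w")
      case True
      then obtain x y where "x \<in> pverts (G v)" "y \<in> pverts (G w)"
        using G by blast
      then show ?thesis
        using arcs[of v w x y] True G by auto
    next
      case False
      then show ?thesis
        using pair_graphD[OF H] pair_graphD[OF H'] V by auto
    qed
  qed (rule V)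
  moreover have "G v = G' v" if v: "v \<in> pverts H" for v
  proof (rule pair_graph_eqI)
    fix x y
    show "(x, y) \<in> parcs (G v) \<longleftrightarrow> (x, y) \<in> parcs (G' v)"
      using arcs[of v v x y] v V pair_graphD(4)[OF H] pair_graphD(4)[OF H'] by auto
  qed (use G v in auto)
  ultimately show "H = H' \<and> (\<forall>v \<in> pverts H. G v = G' v)"
    by blast
qed (use join_along_cong[OF H] in auto)

lemma funpow_complement_graph:
  assumes "pair_graph G"
  shows "(complement_graph ^^ k) G = (if even k then G else complement_graph G)"
proof (induction k)
  case (Suc k)
  have "complement_graph (complement_graph G) = G"
    using pair_graphD[OF assms]
    by (intro pair_graph_eqI) (auto simp: parcs_complement_graph_iff)
  with Suc show ?case
    by simp
qed simp

lemma complement_graph_neq: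
  assumes "nontrivial G"
  shows "complement_graph G \<noteq> G"
proof -
  obtain x y where "x \<in> pverts G" "y \<in> pverts G" "x \<noteq> y"
    using assms unfolding nontrivial_def
    by (metis card_le_Suc0_iff_eq card.infinite less_Suc_eq_le linorder_not_less not_less_zero One_nat_def)
  then show ?thesis
    by (metis parcs_complement_graph_iff)
qed


section \<open>Circulant graphs\<close>

text \<open>
  The step is an integer that only matters modulo \<open>n\<close> and up to sign; the vertices carry the same
  labels as those of the cycle, so that labeled graphs can be compared.
\<close>

definition circulant :: "nat \<Rightarrow> int \<Rightarrow> nat pair_pre_digraph" where
  "circulant n a =
    \<lparr> pverts = {1..n},
      parcs = {(i, j). i \<in> {1..n} \<and> j \<in> {1..n} \<and>
                 (int n dvd int j - int i - a \<or> int n dvd int j - int i + a)} \<rparr>"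

lemma pverts_circulant [simp]: "pverts (circulant n a) = {1..n}"
  by (simp add: circulant_def)

lemma parcs_circulant_iff:
  "(i, j) \<in> parcs (circulant n a) \<longleftrightarrow> i \<in> {1..n} \<and> j \<in> {1..n} \<and>
    (int n dvd int j - int i - a \<or> int n dvd int j - int i + a)"
  by (simp add: circulant_def)

lemma cycle_graph_eq_circulant: "cycle_graph n = circulant n 1"
proof (rule pair_graph_eqI)
  fix i j :: nat
  have "[j = i + 1] (mod n) \<longleftrightarrow> int n dvd int j - int i - 1"
    by (simp flip: cong_int_iff add: cong_iff_dvd_diff algebra_simps)
  moreover have "[i = j + 1] (mod n) \<longleftrightarrow> int n dvd int j - int i + 1"
    by (simp flip: cong_int_iff add: cong_iff_dvd_diff dvd_diff_commute algebra_simps)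
  ultimately show "(i, j) \<in> parcs (cycle_graph n) \<longleftrightarrow> (i, j) \<in> parcs (circulant n 1)"
    by (simp add: cycle_graph_def parcs_circulant_iff)
qed (simp add: cycle_graph_def)

lemma pverts_cycle_graph [simp]: "pverts (cycle_graph n) = {1..n}"
  by (simp add: cycle_graph_def)

lemma residue_label:
  assumes "0 < n"
  obtains i where "i \<in> {1..n}" "int n dvd int i - x"
proof
  let ?i = "nat ((x - 1) mod int n + 1)"
  have r: "0 \<le> (x - 1) mod int n" "(x - 1) mod int n < int n"
    using assms by auto
  then show "?i \<in> {1..n}"
    by auto
  have "int n dvd (x - 1) mod int n - (x - 1)"
    by (metis cong_iff_dvd_diff cong_mod_left cong_refl)
  then show "int n dvd int ?i - x"
    using r by (simp add: algebra_simps)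
qed

lemma residue_label_unique:
  assumes "i \<in> {1..n}" "j \<in> {1..n}" "int n dvd int i - int j"
  shows "i = j"
  using assms zdvd_not_zless[of "int i - int j" "int n"] zdvd_not_zless[of "int j - int i" "int n"]
    dvd_diff_commute[of "int n" "int i" "int j"]
  by (cases i j rule: linorder_cases) auto

lemma coprime_dvd_small_multiple:
  assumes "coprime a (int n)" "int n dvd s * a" "\<bar>s\<bar> < int n"
  shows "s = 0"
  using assms by (metis abs_zero coprime_commute coprime_dvd_mult_left_iff dvd_imp_le_int
      linorder_not_less abs_of_nat)

lemma pair_graph_circulant:
  assumes "2 \<le> n" "coprime a (int n)"
  shows "pair_graph (circulant n a)"
proof -
  have "\<not> int n dvd a"
    using coprime_dvd_small_multiple[OF assms(2), of 1] assms(1) by auto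
  moreover have "int n dvd int j - int i - a \<longleftrightarrow> int n dvd int i - int j + a" for i j :: nat
    by (subst dvd_minus_iff[symmetric]) (simp add: algebra_simps)
  ultimately show ?thesis
    by (auto simp: pair_graph_iff parcs_circulant_iff)
qed

lemma circulant_neighbour:
  assumes "i \<in> {1..n}"
  shows "\<exists>j. (i, j) \<in> parcs (circulant n a)"
proof -
  have "0 < n"
    using assms by auto
  from residue_label[OF this, of "int i + a"] show ?thesis
    using assms by (metis diff_diff_eq parcs_circulant_iff)
qed

lemma circulant_eq_iff:
  assumes "0 < n"
  shows "circulant n a = circulant n b \<longleftrightarrow> int n dvd a - b \<or> int n dvd a + b"
proof
  assume eq: "circulant n a = circulant n b"
  obtain j where j: "j \<in> {1..n}" "int n dvd int j - (int n + a)"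
    using residue_label[OF assms] .
  then have "(n, j) \<in> parcs (circulant n a)"
    using assms by (simp add: parcs_circulant_iff algebra_simps)
  then have "int n dvd int j - int n - b \<or> int n dvd int j - int n + b"
    unfolding eq parcs_circulant_iff by blast
  then show "int n dvd a - b \<or> int n dvd a + b"
    using dvd_diff[OF _ j(2), of "int j - int n - b"] dvd_diff[OF _ j(2), of "int j - int n + b"]
    by (auto simp: algebra_simps)
next
  assume *: "int n dvd a - b \<or> int n dvd a + b"
  have "int n dvd d - a \<longleftrightarrow> int n dvd d - b" "int n dvd d + a \<longleftrightarrow> int n dvd d + b"
    if "int n dvd a - b" for d
    using dvd_add_right_iff[OF that, of "d - a"] dvd_add_right_iff[OF that, of "d + b"]
    by (auto simp: algebra_simps)
  moreover have "int n dvd d - a \<longleftrightarrow> int n dvd d + b" "int n dvd d + a \<longleftrightarrow> int n dvd d - b"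
    if "int n dvd a + b" for d
    using dvd_add_right_iff[OF that, of "d - a"] dvd_add_right_iff[OF that, of "d - b"]
    by (auto simp: algebra_simps)
  ultimately show "circulant n a = circulant n b"
    using * by (intro pair_graph_eqI) (auto simp: parcs_circulant_iff)
qed

lemma metamour_circulant:
  assumes n: "5 \<le> n" "odd n" and a: "coprime a (int n)"
  shows "metamour (circulant n a) = circulant n (2 * a)"
proof (rule pair_graph_eqI)
  fix i j :: nat
  let ?d = "int j - int i"
  have C: "pair_graph (circulant n a)"
    using n a by (intro pair_graph_circulant) auto
  show "(i, j) \<in> parcs (metamour (circulant n a)) \<longleftrightarrow> (i, j) \<in> parcs (circulant n (2 * a))"
  proof
    assume "(i, j) \<in> parcs (metamour (circulant n a))"
    then obtain z where ne: "i \<noteq> j"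
      and z: "(i, z) \<in> parcs (circulant n a)" "(z, j) \<in> parcs (circulant n a)"
      unfolding parcs_metamour_iff[OF C] by blast
    then have ij: "i \<in> {1..n}" "j \<in> {1..n}"
      by (auto simp: parcs_circulant_iff)
    have "\<not> int n dvd ?d"
      using residue_label_unique[OF ij(2,1)] ne by auto
    moreover have "?d = (int z - int i - a) + (int j - int z + a)"
      "?d = (int z - int i + a) + (int j - int z - a)"
      by auto
    ultimately have "int n dvd int z - int i - a \<and> int n dvd int j - int z - a \<or>
        int n dvd int z - int i + a \<and> int n dvd int j - int z + a"
      using z unfolding parcs_circulant_iff by (metis dvd_add)
    then have "int n dvd ?d - 2 * a \<or> int n dvd ?d + 2 * a"
      using dvd_add[of "int n" "int z - int i - a" "int j - int z - a"]
        dvd_add[of "int n" "int z - int i + a" "int j - int z + a"]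
      by (auto simp: algebra_simps)
    with ij show "(i, j) \<in> parcs (circulant n (2 * a))"
      by (simp add: parcs_circulant_iff)
  next
    assume *: "(i, j) \<in> parcs (circulant n (2 * a))"
    then have ij: "i \<in> {1..n}" "j \<in> {1..n}"
      by (auto simp: parcs_circulant_iff)
    obtain b where b: "b = a \<or> b = - a" "int n dvd ?d - 2 * b"
      using * unfolding parcs_circulant_iff by (metis diff_minus_eq_add mult_minus_right)
    \<comment> \<open>If \<open>i\<close> and \<open>j\<close> were equal or adjacent, then \<open>n\<close> would divide one of \<open>2b\<close>, \<open>b\<close>, \<open>3b\<close>;
      as \<open>n\<close> is coprime to \<open>b\<close>, this is excluded by \<open>n > 3\<close>.\<close>
    have b_coprime: "coprime b (int n)"
      using b(1) a by auto
    have far: "\<not> int n dvd s * b" if "s \<in> {1, 2, 3}" for s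
      using coprime_dvd_small_multiple[OF b_coprime, of s] that n by auto
    have "\<not> int n dvd ?d - b" "\<not> int n dvd ?d + b" "\<not> int n dvd ?d"
      using far[of 1] far[of 2] far[of 3] dvd_diff[OF _ b(2), of "?d - b"]
        dvd_diff[OF _ b(2), of "?d + b"] dvd_diff[OF _ b(2), of ?d]
      by auto
    then have "i \<noteq> j" "(i, j) \<notin> parcs (circulant n a)"
      using b(1) by (auto simp: parcs_circulant_iff)
    moreover obtain z where z: "z \<in> {1..n}" "int n dvd int z - (int i + b)"
      using residue_label[of n "int i + b"] n by auto
    have "int n dvd int j - int z - b"
      using dvd_diff[OF b(2) z(2)] by (simp add: algebra_simps)
    with z b(1) ij have "(i, z) \<in> parcs (circulant n a)" "(z, j) \<in> parcs (circulant n a)"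
      by (auto simp: parcs_circulant_iff algebra_simps)
    ultimately show "(i, j) \<in> parcs (metamour (circulant n a))"
      unfolding parcs_metamour_iff[OF C] by blast
  qed
qed simp

lemma coprime_power_two:
  assumes "odd n"
  shows "coprime ((2 :: int) ^ k) (int n)"
  using assms by (simp add: coprime_power_left_iff)

lemma metamour_funpow_join_along_cycle:
  assumes n: "5 \<le> n" "odd n"
    and G: "\<And>i. i \<in> {1..n} \<Longrightarrow> pair_graph (G i)" "\<And>i. i \<in> {1..n} \<Longrightarrow> pverts (G i) \<noteq> {}"
  shows "(metamour ^^ k) (join_along (cycle_graph n) G) =
    join_along (circulant n (2 ^ k)) (\<lambda>i. (complement_graph ^^ k) (G i))"
proof (induction k)
  case 0
  show ?case
    by (simp add: cycle_graph_eq_circulant)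
next
  case (Suc k)
  have *: "pair_graph ((complement_graph ^^ k) (G i))" "pverts ((complement_graph ^^ k) (G i)) \<noteq> {}"
    if "i \<in> {1..n}" for i
    using G[OF that] by (auto simp: funpow_complement_graph pair_graph_complement_graph)
  have "metamour (join_along (circulant n (2 ^ k)) (\<lambda>i. (complement_graph ^^ k) (G i))) =
    join_along (metamour (circulant n (2 ^ k))) (\<lambda>i. complement_graph ((complement_graph ^^ k) (G i)))"
    using n * by (intro metamour_join_along pair_graph_circulant coprime_power_two circulant_neighbour) auto
  with Suc show ?case
    by (simp add: metamour_circulant[OF n coprime_power_two[OF n(2)]])
qed


section \<open>The order of two up to sign\<close>

text \<open>
  Multiplication by \<open>\<plusminus>1\<close> preserves \<open>{1, -1}\<close>, so the condition on \<open>k\<close> is periodic with any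
  exponent that satisfies it; reducing \<open>k\<close> modulo the least positive one leaves \<open>0\<close>.
\<close>

lemma mu_dvd_iff:
  assumes "odd n"
  shows "mu n dvd k \<longleftrightarrow> [2 ^ k = 1] (mod int n) \<or> [2 ^ k = - 1] (mod int n)"
proof -
  define P where "P k \<longleftrightarrow> [2 ^ k = 1] (mod int n) \<or> [2 ^ k = - 1] (mod int n)" for k
  have mu_def': "mu n = (LEAST k. 0 < k \<and> P k)"
    by (simp add: mu_def P_def)
  have "0 < totient n \<and> P (totient n)"
  proof
    show "0 < totient n"
      using assms by (auto intro!: Nat.gr0I)
    have "[int (2 ^ totient n) = int 1] (mod int n)"
      using assms by (subst cong_int_iff) (intro euler_theorem, simp)
    then show "P (totient n)"
      by (simp add: P_def)
  qed
  then have mu: "0 < mu n" "P (mu n)"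
    using LeastI[of "\<lambda>k. 0 < k \<and> P k" "totient n"] unfolding mu_def'[symmetric] by auto
  have P_add: "P (j + k) \<longleftrightarrow> P k" if "P j" for j k
  proof -
    have "[2 ^ (j + k) = 2 ^ k] (mod int n) \<or> [2 ^ (j + k) = - (2 ^ k)] (mod int n)"
      using that cong_scalar_right[of "2 ^ j" 1 "int n" "2 ^ k"]
        cong_scalar_right[of "2 ^ j" "- 1" "int n" "2 ^ k"]
      by (auto simp: P_def power_add)
    then show ?thesis
    proof
      assume "[2 ^ (j + k) = 2 ^ k] (mod int n)"
      then show ?thesis
        by (simp only: P_def cong_def)
    next
      assume eq: "[2 ^ (j + k) = - (2 ^ k)] (mod int n)"
      have "[2 ^ (j + k) = - c] (mod int n) \<longleftrightarrow> [2 ^ k = c] (mod int n)" for c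
        using eq cong_minus_minus_iff[of "2 ^ k" c "int n"] by (simp only: cong_def)
      from this[of 1] this[of "- 1"] show ?thesis
        by (auto simp: P_def)
    qed
  qed
  have P_mult: "P (mu n * q)" for q
  proof (induction q)
    case 0
    show ?case
      by (simp add: P_def)
  next
    case (Suc q)
    with P_add[OF mu(2), of "mu n * q"] show ?case
      by simp
  qed
  have "P k \<longleftrightarrow> P (k mod mu n)"
    using P_add[OF P_mult, of "k div mu n" "k mod mu n"] by simp
  also have "\<dots> \<longleftrightarrow> k mod mu n = 0"
  proof
    assume "P (k mod mu n)"
    moreover have "\<not> (0 < k mod mu n \<and> P (k mod mu n))"
      using mu(1) by (intro not_less_Least[of _ "\<lambda>k. 0 < k \<and> P k", folded mu_def']) simp
    ultimately show "k mod mu n = 0"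
      by simp
  qed (simp add: P_def)
  finally show ?thesis
    by (simp add: P_def dvd_eq_mod_eq_0)
qed

lemma circulant_power_two_eq_cycle_iff:
  assumes "odd n"
  shows "circulant n (2 ^ k) = cycle_graph n \<longleftrightarrow> mu n dvd k"
  unfolding cycle_graph_eq_circulant circulant_eq_iff[OF odd_pos[OF assms]] mu_dvd_iff[OF assms]
  by (simp add: cong_iff_dvd_diff)


section \<open>Isomorphisms of joins\<close>

text \<open>
  The head and tail functions of the target are the projections anyway, so an isomorphism amounts
  to its vertex map.
\<close>

lemma graph_iso_iff:
  assumes G: "pair_graph G" and H: "pair_graph H"
  shows "graph_iso G H \<longleftrightarrow> (\<exists>f. bij_betw f (pverts G) (pverts H) \<and>
    (\<forall>x \<in> pverts G. \<forall>y \<in> pverts G. (f x, f y) \<in> parcs H \<longleftrightarrow> (x, y) \<in> parcs G))"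
    (is "_ \<longleftrightarrow> ?R")
proof
  assume "graph_iso G H"
  then obtain h where h: "pre_digraph.digraph_isomorphism (with_proj G) h"
    and eq: "with_proj H = app_iso h (with_proj G)"
    unfolding digraph_iso_def by blast
  let ?f = "iso_verts h"
  have V: "pverts H = ?f ` pverts G" and A: "parcs H = iso_arcs h ` parcs G"
    and ends: "iso_tail h = fst" "iso_head h = snd"
    using arg_cong[OF eq, of verts] arg_cong[OF eq, of arcs]
      arg_cong[OF eq, of tail] arg_cong[OF eq, of head] by auto
  have inj: "inj_on ?f (pverts G)"
    using h by (simp add: pre_digraph.digraph_isomorphism_def)
  have arc: "iso_arcs h (x, y) = (?f x, ?f y)" if "(x, y) \<in> parcs G" for x y
    using h that ends by (auto simp: pre_digraph.digraph_isomorphism_def prod_eq_iff)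
  have "(?f x, ?f y) \<in> parcs H \<longleftrightarrow> (x, y) \<in> parcs G" if xy: "x \<in> pverts G" "y \<in> pverts G" for x y
  proof
    assume "(?f x, ?f y) \<in> parcs H"
    then obtain x' y' where x'y': "(x', y') \<in> parcs G" "(?f x, ?f y) = (?f x', ?f y')"
      using A arc by auto
    then have "x = x'" "y = y'"
      using inj_onD[OF inj] xy pair_graphD[OF G] by auto
    with x'y' show "(x, y) \<in> parcs G"
      by simp
  next
    assume "(x, y) \<in> parcs G"
    then show "(?f x, ?f y) \<in> parcs H"
      using A arc by (metis imageI)
  qed
  with inj V show ?R
    by (auto simp: bij_betw_def)
next
  assume ?R
  then obtain f where f: "bij_betw f (pverts G) (pverts H)"
    and arcs: "\<And>x y. x \<in> pverts G \<Longrightarrow> y \<in> pverts G \<Longrightarrow> (f x, f y) \<in> parcs H \<longleftrightarrow> (x, y) \<in> parcs G"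
    by blast
  interpret pair_graph G by fact
  let ?h = "\<lparr>iso_verts = f, iso_arcs = map_prod f f, iso_head = snd, iso_tail = fst\<rparr>"
  have inj: "inj_on f (pverts G)" and V: "f ` pverts G = pverts H"
    using f by (auto simp: bij_betw_def)
  have sub: "parcs G \<subseteq> pverts G \<times> pverts G"
    using pair_graphD[OF G] by auto
  have "inj_on (map_prod f f) (parcs G)"
    using map_prod_inj_on[OF inj inj] sub by (rule inj_on_subset)
  then have "pre_digraph.digraph_isomorphism (with_proj G) ?h"
    using inj wf_digraph_axioms by (auto simp: pre_digraph.digraph_isomorphism_def)
  moreover have "map_prod f f ` parcs G = parcs H"
  proof
    show "map_prod f f ` parcs G \<subseteq> parcs H"
      using arcs sub by auto
    show "parcs H \<subseteq> map_prod f f ` parcs G"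
    proof clarify
      fix u v
      assume uv: "(u, v) \<in> parcs H"
      then obtain x y where "x \<in> pverts G" "y \<in> pverts G" "u = f x" "v = f y"
        using V pair_graphD[OF H] by (metis imageE)
      with uv arcs show "(u, v) \<in> map_prod f f ` parcs G"
        by (force simp: image_iff)
    qed
  qed
  then have "with_proj H = app_iso ?h (with_proj G)"
    using V by (simp add: app_iso_def with_proj_def)
  ultimately show "graph_iso G H"
    unfolding digraph_iso_def by blast
qed

lemma graph_iso_sym:
  assumes "pair_graph G" "graph_iso G H"
  shows "graph_iso H G"
proof -
  interpret pair_graph G by fact
  show ?thesis
    using digraph_iso_swap[OF wf_digraph_axioms assms(2)] .
qed

lemma graph_iso_join_along_index:
  assumes H: "pair_graph H" and H': "pair_graph H'" and K: "pair_graph K" and "graph_iso H H'"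
  shows "graph_iso (join_along H (\<lambda>_. K)) (join_along H' (\<lambda>_. K))"
proof -
  obtain f where f: "bij_betw f (pverts H) (pverts H')"
    and arcs: "\<And>v w. v \<in> pverts H \<Longrightarrow> w \<in> pverts H \<Longrightarrow> (f v, f w) \<in> parcs H' \<longleftrightarrow> (v, w) \<in> parcs H"
    using assms(4) unfolding graph_iso_iff[OF H H'] by blast
  have V: "pverts (join_along L (\<lambda>_. K)) = pverts L \<times> pverts K" for L :: "'z pair_pre_digraph"
    by (simp add: join_along_def)
  have "bij_betw (map_prod f id) (pverts H \<times> pverts K) (pverts H' \<times> pverts K)"
    using f by (intro bij_betw_map_prod) auto
  moreover have "f v \<in> pverts H'" if "v \<in> pverts H" for v
    using f that by (auto simp: bij_betw_def)
  moreover have "f v = f w \<longleftrightarrow> v = w" if "v \<in> pverts H" "w \<in> pverts H" for v w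
    using f that by (auto simp: bij_betw_def inj_on_eq_iff)
  ultimately show ?thesis
    using arcs
    by (subst graph_iso_iff[OF pair_graph_join_along[OF H K] pair_graph_join_along[OF H' K]])
      (auto simp: V parcs_join_along_iff[OF H] parcs_join_along_iff[OF H'] intro!: exI[of _ "map_prod f id"])
qed

text \<open>Multiplication by \<open>a\<close> permutes the residues modulo \<open>n\<close> and scales every difference by \<open>a\<close>.\<close>

lemma graph_iso_circulant:
  assumes n: "2 \<le> n" and a: "coprime a (int n)"
  shows "graph_iso (circulant n 1) (circulant n a)"
proof -
  have "\<forall>i. \<exists>j. j \<in> {1..n} \<and> int n dvd int j - a * int i"
    using residue_label[of n] n by (metis le_zero_eq not_gr_zero not_numeral_le_zero)
  then obtain f where f: "\<And>i. f i \<in> {1..n}" "\<And>i. int n dvd int (f i) - a * int i"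
    by metis
  have scale: "int n dvd int (f j) - int (f i) + a * t \<longleftrightarrow> int n dvd int j - int i + t" for i j t
  proof -
    have "int n dvd (int (f j) - a * int j) - (int (f i) - a * int i)"
      by (rule dvd_diff[OF f(2) f(2)])
    from dvd_add_right_iff[OF this, of "a * (int j - int i + t)"]
    have "int n dvd int (f j) - int (f i) + a * t \<longleftrightarrow> int n dvd a * (int j - int i + t)"
      by (simp add: algebra_simps)
    also have "\<dots> \<longleftrightarrow> int n dvd int j - int i + t"
      using a by (simp add: coprime_commute coprime_dvd_mult_right_iff)
    finally show ?thesis .
  qed
  have inj: "inj_on f {1..n}"
    using scale[where t = 0] residue_label_unique by (intro inj_onI) (metis add_0_right diff_self dvd_0_right mult_zero_right)
  have "f ` {1..n} \<subseteq> {1..n}"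
    using f(1) by blast
  with inj have "bij_betw f {1..n} {1..n}"
    by (simp add: bij_betw_def endo_inj_surj)
  moreover have "(f i, f j) \<in> parcs (circulant n a) \<longleftrightarrow> (i, j) \<in> parcs (circulant n 1)"
    if "i \<in> {1..n}" "j \<in> {1..n}" for i j
    using that f(1) scale[of j i 1] scale[of j i "- 1"] by (simp add: parcs_circulant_iff)
  ultimately show ?thesis
    using n a by (subst graph_iso_iff) (auto intro: pair_graph_circulant)
qed


section \<open>Recovering the parts of a join from its balls of radius two\<close>

definition ball2 :: "'a pair_pre_digraph \<Rightarrow> 'a \<Rightarrow> 'a set" where
  "ball2 G x = {y \<in> pverts G. y = x \<or> (x, y) \<in> parcs G \<or> (\<exists>z. (x, z) \<in> parcs G \<and> (z, y) \<in> parcs G)}"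

lemma ball2_join_along:
  assumes H: "pair_graph H" and G: "\<And>v. v \<in> pverts H \<Longrightarrow> pair_graph (G v)"
    and no_isolated: "\<And>v. v \<in> pverts H \<Longrightarrow> \<exists>w. (v, w) \<in> parcs H"
    and nonempty: "\<And>v. v \<in> pverts H \<Longrightarrow> pverts (G v) \<noteq> {}"
    and v: "v \<in> pverts H" and x: "x \<in> pverts (G v)"
  shows "ball2 (join_along H G) (v, x) = (SIGMA w : ball2 H v. pverts (G w))"
proof -
  note HD = pair_graphD[OF H]
  have "(w, y) \<in> ball2 (join_along H G) (v, x) \<longleftrightarrow> w \<in> ball2 H v \<and> y \<in> pverts (G w)" for w y
  proof
    assume "(w, y) \<in> ball2 (join_along H G) (v, x)"
    then show "w \<in> ball2 H v \<and> y \<in> pverts (G w)"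
      by (auto simp: ball2_def parcs_join_along_iff[OF H])
  next
    assume *: "w \<in> ball2 H v \<and> y \<in> pverts (G w)"
    then have w: "w \<in> pverts H" and y: "y \<in> pverts (G w)"
      by (auto simp: ball2_def)
    have via: "\<exists>r. ((v, x), r) \<in> parcs (join_along H G) \<and> (r, (w, y)) \<in> parcs (join_along H G)"
      if u: "(v, u) \<in> parcs H" "(u, w) \<in> parcs H" for u
    proof -
      obtain z where "z \<in> pverts (G u)"
        using nonempty[OF HD(3)[OF u(1)]] by blast
      then show ?thesis
        using u x y by (intro exI[of _ "(u, z)"]) (simp add: parcs_join_along_iff[OF H])
    qed
    consider "w = v" | "(v, w) \<in> parcs H" | u where "(v, u) \<in> parcs H" "(u, w) \<in> parcs H"
      using * by (auto simp: ball2_def)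
    then show "(w, y) \<in> ball2 (join_along H G) (v, x)"
    proof cases
      case 1
      obtain u where u: "(v, u) \<in> parcs H"
        using no_isolated[OF v] by blast
      with 1 HD(5)[OF u] via[of u] show ?thesis
        using w y by (simp add: ball2_def)
    next
      case 2
      then show ?thesis
        using w x y by (simp add: ball2_def parcs_join_along_iff[OF H])
    next
      case 3
      with via[of u] show ?thesis
        using w y by (simp add: ball2_def)
    qed
  qed
  then show ?thesis
    by auto
qed

lemma ball2_join_along_eq_iff:
  assumes H: "pair_graph H" and G: "\<And>v. v \<in> pverts H \<Longrightarrow> pair_graph (G v)"
    and no_isolated: "\<And>v. v \<in> pverts H \<Longrightarrow> \<exists>w. (v, w) \<in> parcs H"
    and nonempty: "\<And>v. v \<in> pverts H \<Longrightarrow> pverts (G v) \<noteq> {}"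
    and balls: "inj_on (ball2 H) (pverts H)"
    and p: "p \<in> pverts (join_along H G)" and q: "q \<in> pverts (join_along H G)"
  shows "ball2 (join_along H G) p = ball2 (join_along H G) q \<longleftrightarrow> fst p = fst q"
proof -
  have in_H: "fst r \<in> pverts H" and in_G: "snd r \<in> pverts (G (fst r))"
    if "r \<in> pverts (join_along H G)" for r
    using that by (cases r; simp)+
  have ball: "ball2 (join_along H G) r = (SIGMA w : ball2 H (fst r). pverts (G w))"
    if "r \<in> pverts (join_along H G)" for r
  proof -
    have "ball2 (join_along H G) (fst r, snd r) = (SIGMA w : ball2 H (fst r). pverts (G w))"
      by (intro ball2_join_along H G no_isolated nonempty in_H in_G that)
    then show ?thesis
      by simp
  qed
  have sub: "ball2 H v \<subseteq> pverts H" for v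
    by (auto simp: ball2_def)
  have fst_ball: "fst ` (SIGMA w : ball2 H v. pverts (G w)) = ball2 H v" for v
    unfolding fst_image_Sigma using sub nonempty by blast
  show ?thesis
  proof
    assume "ball2 (join_along H G) p = ball2 (join_along H G) q"
    then have "ball2 H (fst p) = ball2 H (fst q)"
      unfolding ball[OF p] ball[OF q] by (metis fst_ball)
    then show "fst p = fst q"
      using inj_onD[OF balls _ in_H[OF p] in_H[OF q]] by blast
  qed (simp add: ball p q)
qed

lemma ball2_isomorphism:
  assumes G: "pair_graph G" and H: "pair_graph H" and f: "bij_betw f (pverts G) (pverts H)"
    and arcs: "\<And>x y. x \<in> pverts G \<Longrightarrow> y \<in> pverts G \<Longrightarrow> (f x, f y) \<in> parcs H \<longleftrightarrow> (x, y) \<in> parcs G"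
    and x: "x \<in> pverts G"
  shows "ball2 H (f x) = f ` ball2 G x"
proof -
  have inj: "inj_on f (pverts G)" and surj: "f ` pverts G = pverts H"
    using f by (auto simp: bij_betw_def)
  have mem: "f y \<in> ball2 H (f x) \<longleftrightarrow> y \<in> ball2 G x" if y: "y \<in> pverts G" for y
  proof -
    have "(\<exists>u. (f x, u) \<in> parcs H \<and> (u, f y) \<in> parcs H) \<longleftrightarrow> (\<exists>z. (x, z) \<in> parcs G \<and> (z, y) \<in> parcs G)"
    proof
      assume "\<exists>u. (f x, u) \<in> parcs H \<and> (u, f y) \<in> parcs H"
      then obtain u where u: "(f x, u) \<in> parcs H" "(u, f y) \<in> parcs H"
        by blast
      then obtain z where z: "z \<in> pverts G" "u = f z"
        using pair_graphD(3)[OF H u(1)] surj by blast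
      with u arcs[OF x z(1)] arcs[OF z(1) y] show "\<exists>z. (x, z) \<in> parcs G \<and> (z, y) \<in> parcs G"
        by blast
    next
      assume "\<exists>z. (x, z) \<in> parcs G \<and> (z, y) \<in> parcs G"
      then obtain z where z: "(x, z) \<in> parcs G" "(z, y) \<in> parcs G"
        by blast
      with arcs[OF x pair_graphD(3)[OF G z(1)]] arcs[OF pair_graphD(3)[OF G z(1)] y]
      show "\<exists>u. (f x, u) \<in> parcs H \<and> (u, f y) \<in> parcs H"
        by blast
    qed
    moreover have "f y \<in> pverts H" "f y = f x \<longleftrightarrow> y = x"
      using inj surj x y by (auto simp: inj_on_eq_iff)
    ultimately show ?thesis
      using arcs[OF x y] y by (simp add: ball2_def)
  qed
  have "ball2 G x \<subseteq> pverts G" "ball2 H (f x) \<subseteq> f ` pverts G"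
    by (auto simp: ball2_def surj)
  with mem show ?thesis
    by blast
qed

text \<open>
  Vertices of the join lie in the same part exactly when their balls of radius \<open>2\<close> agree, so an
  isomorphism maps every part onto a part.
\<close>

lemma graph_iso_join_along_parts:
  assumes H: "pair_graph H" and G: "\<And>v. v \<in> pverts H \<Longrightarrow> pair_graph (G v)"
    and no_isolated: "\<And>v. v \<in> pverts H \<Longrightarrow> \<exists>w. (v, w) \<in> parcs H"
    and nonempty: "\<And>v. v \<in> pverts H \<Longrightarrow> pverts (G v) \<noteq> {}"
    and balls: "inj_on (ball2 H) (pverts H)"
    and H': "pair_graph H'" and G': "\<And>v. v \<in> pverts H' \<Longrightarrow> pair_graph (G' v)"
    and no_isolated': "\<And>v. v \<in> pverts H' \<Longrightarrow> \<exists>w. (v, w) \<in> parcs H'"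
    and nonempty': "\<And>v. v \<in> pverts H' \<Longrightarrow> pverts (G' v) \<noteq> {}"
    and balls': "inj_on (ball2 H') (pverts H')"
    and iso: "graph_iso (join_along H G) (join_along H' G')"
    and v: "v \<in> pverts H"
  obtains w where "w \<in> pverts H'" "graph_iso (G v) (G' w)"
proof -
  let ?J = "join_along H G" and ?J' = "join_along H' G'"
  have J: "pair_graph ?J"
    by (rule pair_graph_join_along[OF H G])
  have J': "pair_graph ?J'"
    by (rule pair_graph_join_along[OF H' G'])
  obtain f where f: "bij_betw f (pverts ?J) (pverts ?J')"
    and arcs: "\<And>p q. p \<in> pverts ?J \<Longrightarrow> q \<in> pverts ?J \<Longrightarrow> (f p, f q) \<in> parcs ?J' \<longleftrightarrow> (p, q) \<in> parcs ?J"
    using iso unfolding graph_iso_iff[OF J J'] by blast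
  have inj: "inj_on f (pverts ?J)" and surj: "f ` pverts ?J = pverts ?J'"
    using f by (auto simp: bij_betw_def)
  have same_part: "fst (f p) = fst (f q) \<longleftrightarrow> fst p = fst q"
    if "p \<in> pverts ?J" "q \<in> pverts ?J" for p q
  proof -
    have images: "f p \<in> pverts ?J'" "f q \<in> pverts ?J'"
      using that surj by auto
    have "fst (f p) = fst (f q) \<longleftrightarrow> ball2 ?J' (f p) = ball2 ?J' (f q)"
      by (rule ball2_join_along_eq_iff[OF H' G' no_isolated' nonempty' balls' images, symmetric])
    also have "ball2 ?J' (f p) = f ` ball2 ?J p"
      by (rule ball2_isomorphism[OF J J' f arcs that(1)])
    also have "ball2 ?J' (f q) = f ` ball2 ?J q"
      by (rule ball2_isomorphism[OF J J' f arcs that(2)])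
    also have "f ` ball2 ?J p = f ` ball2 ?J q \<longleftrightarrow> ball2 ?J p = ball2 ?J q"
      by (rule inj_on_image_eq_iff[OF inj]) (auto simp: ball2_def)
    also have "\<dots> \<longleftrightarrow> fst p = fst q"
      by (rule ball2_join_along_eq_iff[OF H G no_isolated nonempty balls that])
    finally show ?thesis .
  qed
  obtain x0 where x0: "x0 \<in> pverts (G v)"
    using nonempty[OF v] by blast
  define w where "w = fst (f (v, x0))"
  define g where "g x = snd (f (v, x))" for x
  have vx: "(v, x) \<in> pverts ?J" if "x \<in> pverts (G v)" for x
    using that v by simp
  have f_eq: "f (v, x) = (w, g x)" if "x \<in> pverts (G v)" for x
    using same_part[OF vx[OF that] vx[OF x0]] by (simp add: w_def g_def prod_eq_iff)
  have f_in: "(w, g x) \<in> pverts ?J'" if "x \<in> pverts (G v)" for x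
    using surj vx[OF that] f_eq[OF that] by (metis imageI)
  have w: "w \<in> pverts H'"
    using f_in[OF x0] by simp
  have "bij_betw g (pverts (G v)) (pverts (G' w))"
  proof (rule bij_betw_imageI)
    show "inj_on g (pverts (G v))"
      using inj_onD[OF inj _ vx vx] f_eq by (intro inj_onI) (metis prod.inject)
    show "g ` pverts (G v) = pverts (G' w)"
    proof
      show "g ` pverts (G v) \<subseteq> pverts (G' w)"
        using f_in by auto
      show "pverts (G' w) \<subseteq> g ` pverts (G v)"
      proof
        fix y
        assume "y \<in> pverts (G' w)"
        then have "(w, y) \<in> f ` pverts ?J"
          using surj w by simp
        then obtain v' x where p: "(v', x) \<in> pverts ?J" "f (v', x) = (w, y)"
          by auto
        then have "v' = v"
          using same_part[OF p(1) vx[OF x0]] by (simp add: w_def)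
        with p show "y \<in> g ` pverts (G v)"
          by (auto simp: g_def image_iff intro!: bexI[of _ x])
      qed
    qed
  qed
  moreover have "(g x, g y) \<in> parcs (G' w) \<longleftrightarrow> (x, y) \<in> parcs (G v)"
    if "x \<in> pverts (G v)" "y \<in> pverts (G v)" for x y
    using arcs[OF vx[OF that(1)] vx[OF that(2)]] v w pair_graphD(4)[OF H] pair_graphD(4)[OF H']
    by (simp add: f_eq that parcs_join_along_iff[OF H] parcs_join_along_iff[OF H'])
  ultimately have "graph_iso (G v) (G' w)"
    using graph_iso_iff[OF G[OF v] G'[OF w]] by blast
  with w show thesis
    by (rule that)
qed

lemma ball2_circulant_iff:
  assumes "i \<in> {1..n}" and j: "j \<in> {1..n}"
  shows "j \<in> ball2 (circulant n a) i \<longleftrightarrow> (\<exists>s \<in> {-2..2}. int n dvd int j - int i - s * a)"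
proof
  let ?arcs = "parcs (circulant n a)"
  assume "j \<in> ball2 (circulant n a) i"
  then consider "j = i" | "(i, j) \<in> ?arcs" | z where "(i, z) \<in> ?arcs" "(z, j) \<in> ?arcs"
    by (auto simp: ball2_def)
  then show "\<exists>s \<in> {-2..2}. int n dvd int j - int i - s * a"
  proof cases
    case 1
    then show ?thesis
      by (intro bexI[of _ 0]) auto
  next
    case 2
    then have "int n dvd int j - int i - 1 * a \<or> int n dvd int j - int i - (- 1) * a"
      by (simp add: parcs_circulant_iff)
    then show ?thesis
      by (metis atLeastAtMost_iff neg_le_iff_le one_le_numeral order.trans neg_numeral_le_one
          neg_one_le_numeral)
  next
    case 3
    have step: "\<exists>s \<in> {-1, 1}. int n dvd int q - int p - s * a" if "(p, q) \<in> ?arcs" for p q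
      using that by (auto simp: parcs_circulant_iff)
    obtain s t where st: "s \<in> {-1, 1}" "t \<in> {-1, 1}"
      "int n dvd int z - int i - s * a" "int n dvd int j - int z - t * a"
      using step[OF 3(1)] step[OF 3(2)] by blast
    have "int n dvd int j - int i - (s + t) * a"
      using dvd_add[OF st(3,4)] by (simp add: algebra_simps)
    with st(1,2) show ?thesis
      by (intro bexI[of _ "s + t"]) auto
  qed
next
  let ?arcs = "parcs (circulant n a)"
  assume "\<exists>s \<in> {-2..2}. int n dvd int j - int i - s * a"
  then obtain s where s: "s \<in> {-2..2}" "int n dvd int j - int i - s * a"
    by blast
  have two: "\<exists>z. (i, z) \<in> ?arcs \<and> (z, j) \<in> ?arcs"
    if b: "b = a \<or> b = - a" "int n dvd int j - int i - 2 * b" for b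
  proof -
    obtain z where z: "z \<in> {1..n}" "int n dvd int z - (int i + b)"
      using residue_label[of n "int i + b"] j by auto
    have "int n dvd int j - int z - b"
      using dvd_diff[OF b(2) z(2)] by (simp add: algebra_simps)
    with z b(1) assms show ?thesis
      by (intro exI[of _ z]) (auto simp: parcs_circulant_iff algebra_simps)
  qed
  have "s = -2 \<or> s = -1 \<or> s = 0 \<or> s = 1 \<or> s = 2"
    using s(1) by auto
  then show "j \<in> ball2 (circulant n a) i"
    using s(2) assms residue_label_unique[OF j assms(1)] two[of a] two[of "- a"]
    by (auto simp: ball2_def parcs_circulant_iff)
qed

text \<open>
  Measured in multiples of the step \<open>a\<close>, the ball around \<open>i\<close> is the window \<open>-2, \<dots>, 2\<close> centred at
  \<open>i\<close>.  Centres with the same ball lie in each other's window, and modulo \<open>n \<ge> 7\<close> a nonzero shift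
  of the centre by at most \<open>2\<close> moves an end of the window out of it.
\<close>

lemma inj_on_ball2_circulant:
  assumes n: "7 \<le> n" and a: "coprime a (int n)"
  shows "inj_on (ball2 (circulant n a)) {1..n}"
proof (rule inj_onI)
  fix i j
  assume i: "i \<in> {1..n}" and j: "j \<in> {1..n}"
    and eq: "ball2 (circulant n a) i = ball2 (circulant n a) j"
  have "j \<in> ball2 (circulant n a) j"
    using j by (simp add: ball2_def)
  then obtain s where s: "s \<in> {-2..2}" "int n dvd int j - int i - s * a"
    unfolding eq[symmetric] ball2_circulant_iff[OF i j] by blast
  \<comment> \<open>The vertex \<open>u\<close> is the end of the window around \<open>j\<close> that points away from \<open>i\<close>.\<close>
  define e :: int where "e = (if 0 < s then 2 else -2)"
  obtain u where u: "u \<in> {1..n}" "int n dvd int u - (int j + e * a)"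
    using residue_label[of n "int j + e * a"] n by auto
  have "u \<in> ball2 (circulant n a) j"
    unfolding ball2_circulant_iff[OF j u(1)]
    using u(2) by (intro bexI[of _ e]) (auto simp: e_def algebra_simps)
  then obtain t where t: "t \<in> {-2..2}" "int n dvd int u - int i - t * a"
    unfolding eq[symmetric] ball2_circulant_iff[OF i u(1)] by blast
  have "int n dvd (int u - int i - t * a) - (int u - (int j + e * a)) - (int j - int i - s * a)"
    by (rule dvd_diff[OF dvd_diff[OF t(2) u(2)] s(2)])
  then have "int n dvd (s + e - t) * a"
    by (simp add: algebra_simps)
  \<comment> \<open>For \<open>s \<noteq> 0\<close> the number \<open>s + e\<close> is \<open>\<plusminus>3\<close> or \<open>\<plusminus>4\<close>, so it differs from \<open>t\<close> by at least \<open>1\<close>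
    and at most \<open>6\<close>.\<close>
  then have "s + e - t = 0"
    using s(1) t(1) n by (intro coprime_dvd_small_multiple[OF a]) (auto simp: e_def)
  with s(1) t(1) have "s = 0"
    by (auto simp: e_def split: if_splits)
  with s(2) residue_label_unique[OF j i] show "i = j"
    by simp
qed

theorem theorem5p5:
  fixes n k l :: nat and G :: "nat \<Rightarrow> 'a pair_pre_digraph"
  assumes "5 \<le> n" and "odd n"
    and "\<forall>i \<in> {1..n}. pair_graph (G i) \<and> pverts (G i) \<noteq> {}"
    and "\<exists>i \<in> {1..n}. nontrivial (G i)"
  shows "((metamour ^^ k) (join_along (cycle_graph n) G) = join_along (cycle_graph n) G
            \<longleftrightarrow> mu n dvd k \<and> even k)
    \<and> ((metamour ^^ k) (join_along (cycle_graph n) G)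
            = join_along (cycle_graph n) (\<lambda>i. complement_graph (G i))
            \<longleftrightarrow> mu n dvd k \<and> odd k)
    \<and> (7 \<le> n \<and>
       (\<forall>i \<in> {1..n}. \<forall>j \<in> {1..n}.
          \<not> graph_iso (complement_graph (G i)) (G i) \<and> G i = G j)
       \<longrightarrow> (graph_iso ((metamour ^^ k) (join_along (cycle_graph n) G))
                      ((metamour ^^ l) (join_along (cycle_graph n) G))
            \<longleftrightarrow> [k = l] (mod 2)))"
proof -
  have G: "pair_graph (G i)" "pverts (G i) \<noteq> {}" if "i \<in> {1..n}" for i
    using assms(3) that by auto
  have circ: "pair_graph (circulant n (2 ^ k))" for k
    using assms(1) coprime_power_two[OF assms(2)] by (intro pair_graph_circulant) auto
  have cyc: "pair_graph (cycle_graph n)"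
    using assms(1) by (intro pair_graph_cycle_graph) simp
  have Mk: "(metamour ^^ k) (join_along (cycle_graph n) G) =
      join_along (circulant n (2 ^ k)) (\<lambda>i. (complement_graph ^^ k) (G i))" for k
    using metamour_funpow_join_along_cycle[OF assms(1,2) G] .
  obtain i0 where i0: "i0 \<in> {1..n}" "nontrivial (G i0)"
    using assms(4) by blast
  have even_iff: "(\<forall>i \<in> {1..n}. (complement_graph ^^ k) (G i) = G i) \<longleftrightarrow> even k"
    using G i0 complement_graph_neq[OF i0(2)] by (auto simp: funpow_complement_graph)
  have odd_iff: "(\<forall>i \<in> {1..n}. (complement_graph ^^ k) (G i) = complement_graph (G i)) \<longleftrightarrow> odd k"
    using G i0 complement_graph_neq[OF i0(2)] by (auto simp: funpow_complement_graph)
  have V: "pverts ((complement_graph ^^ k) (G i)) = pverts (G i)" if "i \<in> {1..n}" for i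
    using G[OF that] by (simp add: funpow_complement_graph)
  have claim1: "(metamour ^^ k) (join_along (cycle_graph n) G) = join_along (cycle_graph n) G
      \<longleftrightarrow> mu n dvd k \<and> even k"
    unfolding Mk
    by (subst join_along_eq_iff[OF circ cyc])
      (auto simp: V G circulant_power_two_eq_cycle_iff[OF assms(2)] even_iff[simplified])
  have claim2: "(metamour ^^ k) (join_along (cycle_graph n) G)
      = join_along (cycle_graph n) (\<lambda>i. complement_graph (G i)) \<longleftrightarrow> mu n dvd k \<and> odd k"
    unfolding Mk
    by (subst join_along_eq_iff[OF circ cyc])
      (auto simp: V G circulant_power_two_eq_cycle_iff[OF assms(2)] odd_iff[simplified])
  have claim3: "graph_iso ((metamour ^^ k) (join_along (cycle_graph n) G))
        ((metamour ^^ l) (join_along (cycle_graph n) G)) \<longleftrightarrow> [k = l] (mod 2)"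
    if n: "7 \<le> n" and same: "\<forall>i \<in> {1..n}. \<forall>j \<in> {1..n}.
          \<not> graph_iso (complement_graph (G i)) (G i) \<and> G i = G j"
  proof -
    define K where "K = G 1"
    have one: "1 \<in> {1..n}"
      using n by auto
    have K: "pair_graph K" "pverts K \<noteq> {}" "\<not> graph_iso (complement_graph K) K"
      using G[OF one] bspec[OF bspec[OF same one] one] unfolding K_def by blast+
    have K': "\<not> graph_iso K (complement_graph K)"
      using K graph_iso_sym by blast
    define L where "L k = (complement_graph ^^ k) K" for k
    have L: "pair_graph (L k)" "pverts (L k) \<noteq> {}" for k
      using K by (auto simp: L_def funpow_complement_graph pair_graph_complement_graph)
    have "G i = K" if "i \<in> {1..n}" for i
      using same one that unfolding K_def by blast
    then have Mk': "(metamour ^^ k) (join_along (cycle_graph n) G) =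
        join_along (circulant n (2 ^ k)) (\<lambda>_. L k)" for k
      unfolding Mk L_def by (intro join_along_cong circ) simp
    show ?thesis
      unfolding Mk'
    proof
      assume iso: "graph_iso (join_along (circulant n (2 ^ k)) (\<lambda>_. L k))
        (join_along (circulant n (2 ^ l)) (\<lambda>_. L l))"
      have no_isolated: "\<exists>j. (i, j) \<in> parcs (circulant n (2 ^ m))"
        if "i \<in> pverts (circulant n (2 ^ m))" for i m
        using circulant_neighbour that by simp
      have balls: "inj_on (ball2 (circulant n (2 ^ m))) (pverts (circulant n (2 ^ m)))" for m
        using inj_on_ball2_circulant[OF n coprime_power_two[OF assms(2)]] by simp
      have one': "1 \<in> pverts (circulant n (2 ^ k))"
        using one by simp
      have "graph_iso (L k) (L l)"
        by (rule graph_iso_join_along_parts[where G = "\<lambda>_. L k" and G' = "\<lambda>_. L l",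
              OF circ L(1) no_isolated L(2) balls circ L(1) no_isolated L(2) balls iso one'])
      with K K' show "[k = l] (mod 2)"
        by (auto simp: L_def funpow_complement_graph cong_def mod2_eq_if split: if_splits)
    next
      assume "[k = l] (mod 2)"
      then have "even k \<longleftrightarrow> even l"
        by (simp add: cong_def mod2_eq_if split: if_splits)
      then have "L k = L l"
        using K by (simp add: L_def funpow_complement_graph)
      moreover have "graph_iso (circulant n 1) (circulant n (2 ^ j))" for j
        using n coprime_power_two[OF assms(2)] by (intro graph_iso_circulant) auto
      then have "graph_iso (circulant n (2 ^ k)) (circulant n (2 ^ l))"
        using circ[of 0] graph_iso_sym[of "circulant n 1"] digraph_iso_trans by (metis power_0)
      ultimately show "graph_iso (join_along (circulant n (2 ^ k)) (\<lambda>_. L k))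
        (join_along (circulant n (2 ^ l)) (\<lambda>_. L l))"
        using graph_iso_join_along_index[OF circ circ L(1)] by simp
    qed
  qed
  show ?thesis
    using claim1 claim2 claim3 by blast
qed

end
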